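(* Let $\mathcal{F} = \{f_i\}_{i \in I}$ be a sequence in $H$ and let $a \colon I \to G$ be a map. If (a) $(\mathcal{F},a)$ is $\ell^1$-self-localized, (b) $D^+(I,a) < \infty$, and (c) $\inf_{i\in I} \|f_i\| > 0$, then for each $\varepsilon$ with $0 < \varepsilon < 1$ and $\varepsilon < \inf_{i\in I} \|f_i\|$, $\mathcal{F}$ can be written as a finite union of $\varepsilon$-Riesz sequences; that is, $I$ can be partitioned into finitely many subsets $I_1,\dots,I_n$ such that each $\{f_i\}_{i\in I_k}$ is an $\varepsilon$-Riesz sequence.
   Context: $H$ is a separable Hilbert space and $I$ is a countable index set. $G = \prod_{i=1}^d a_i \mathbf{Z} \times \prod_{j=1}^e \mathbf{Z}_{n_j}$ (with $d \ge 1$, $a_i>0$, a countably infinite abelian group), equipped with $|g| = \sup\{|a_1 k_1|,\dots,|a_d k_d|,\delta(m_1),\dots,\delta(m_e)\}$ for $g=(a_1k_1,\dots,a_dk_d,m_1,\dots,m_e)$, where $\delta(0)=0$ and $\delta(m)=1$ for $m\neq 0$. For $N \in \mathbf{N}$ and $j\in G$ put $S_N(j) = \{k \in G : |k-j| \le N/2\}$ and $I_N(j) = a^{-1}(S_N(j))$. The upper density is $D^+(I,a) = \limsup_{N\to\infty} \sup_{j\in G} |I_N(j)|/|S_N(j)|$. $(\mathcal{F},a)$ is $\ell^1$-self-localized if there exists $r\in\ell^1(G)$ such that $|\langle f_i,f_j\rangle|\le r_{a(i)-a(j)}$ for all $i,j\in I$. For $0<\varepsilon<1$, a sequence $\{g_i\}_{i\in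 J}$ in $H$ is an $\varepsilon$-Riesz sequence if there exists a constant $A>0$ such that for every $(c_i)_{i\in J}\in\ell^2(J)$, $$(1-\varepsilon)A\sum_{i\in J}|c_i|^2 \le \Bigl\|\sum_{i\in J}c_ig_i\Bigr\|^2 \le (1+\varepsilon)A\sum_{i\in J}|c_i|^2.$$ *)

theory Defs
  imports
    "HOL-Analysis.Analysis"
    "HOL-Algebra.Product_Groups"
begin

(* Complex Hilbert spaces; the inner product is linear in the first argument. The real
   structure of real_normed_vector is the restriction of scalars of the complex one, and
   cinner_self makes the inner product positive definite, with the ambient norm as its norm. *)

class complex_inner = real_normed_vector +
  fixes scaleC :: "complex \<Rightarrow> 'a \<Rightarrow> 'a" (infixr \<open>*\<^sub>C\<close> 75)
    and cinner :: "'a \<Rightarrow> 'a \<Rightarrow> complex"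
  assumes scaleC_add_right: "c *\<^sub>C (x + y) = c *\<^sub>C x + c *\<^sub>C y"
    and scaleC_add_left: "(b + c) *\<^sub>C x = b *\<^sub>C x + c *\<^sub>C x"
    and scaleC_scaleC: "b *\<^sub>C c *\<^sub>C x = (b * c) *\<^sub>C x"
    and scaleC_of_real: "complex_of_real r *\<^sub>C x = r *\<^sub>R x"
    and cinner_commute: "cinner x y = cnj (cinner y x)"
    and cinner_add_left: "cinner (x + y) z = cinner x z + cinner y z"
    and cinner_scaleC_left: "cinner (c *\<^sub>C x) y = c * cinner x y"
    and cinner_self: "cinner x x = complex_of_real ((norm x)\<^sup>2)"

class chilbert_space = complex_inner + complete_space

(* aZ, as a subgroup of (R, +) *)
definition multiples_group :: "real \<Rightarrow> real monoid" where
  "multiples_group \<alpha> =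
     \<lparr>carrier = range (\<lambda>k::int. \<alpha> * of_int k), monoid.mult = (+), one = 0\<rparr>"

(* Indices run from 0: the constants are \<alpha> 0, ..., \<alpha> (d - 1) and n 0, ..., n (e - 1).
   For n j = 0 the library's integer_mod_group is Z, so positivity of the n j has to be
   assumed where this group is used; e = 0 is allowed. *)
definition lattice_group ::
  "nat \<Rightarrow> (nat \<Rightarrow> real) \<Rightarrow> nat \<Rightarrow> (nat \<Rightarrow> nat) \<Rightarrow> ((nat \<Rightarrow> real) \<times> (nat \<Rightarrow> int)) monoid" where
  "lattice_group d \<alpha> e n =
     product_group {..<d} (\<lambda>i. multiples_group (\<alpha> i)) \<times>\<times>
     product_group {..<e} (\<lambda>j. integer_mod_group (n j))"

definition lattice_abs :: "nat \<Rightarrow> nat \<Rightarrow> (nat \<Rightarrow> real) \<times> (nat \<Rightarrow> int) \<Rightarrow> real" where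
  "lattice_abs d e g =
     Sup ((\<lambda>i. \<bar>fst g i\<bar>) ` {..<d} \<union> (\<lambda>j. if snd g j = 0 then 0 else 1) ` {..<e})"

(* The group G is written multiplicatively, so x \<otimes> inv y is the difference x - y. *)
definition group_box :: "('g, 'm) monoid_scheme \<Rightarrow> ('g \<Rightarrow> real) \<Rightarrow> nat \<Rightarrow> 'g \<Rightarrow> 'g set" where
  "group_box G nrm N j = {k \<in> carrier G. nrm (k \<otimes>\<^bsub>G\<^esub> inv\<^bsub>G\<^esub> j) \<le> real N / 2}"

(* |I_N(j)| is taken in [0, \<infinity>], as the counting measure, because I_N(j) may be infinite.
   S_N(j) is finite and nonempty for the lattice groups above. *)
definition upper_density ::
  "('g, 'm) monoid_scheme \<Rightarrow> ('g \<Rightarrow> real) \<Rightarrow> 'i set \<Rightarrow> ('i \<Rightarrow> 'g) \<Rightarrow> ennreal" where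
  "upper_density G nrm I a =
     limsup (\<lambda>N. SUP j\<in>carrier G.
       emeasure (count_space I) {i \<in> I. a i \<in> group_box G nrm N j} /
       of_nat (card (group_box G nrm N j)))"

definition l1_self_localized ::
  "('g, 'm) monoid_scheme \<Rightarrow> 'i set \<Rightarrow> ('i \<Rightarrow> 'h::complex_inner) \<Rightarrow> ('i \<Rightarrow> 'g) \<Rightarrow> bool" where
  "l1_self_localized G I f a \<longleftrightarrow>
     (\<exists>r::'g \<Rightarrow> real. (\<lambda>g. \<bar>r g\<bar>) summable_on carrier G \<and>
       (\<forall>i\<in>I. \<forall>j\<in>I. cmod (cinner (f i) (f j)) \<le> r (a i \<otimes>\<^bsub>G\<^esub> inv\<^bsub>G\<^esub> (a j))))"

(* The index set carries no order, so the sum of the c i *\<^sub>C g i is the unconditional sum.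
   Its convergence is part of the definition. *)
definition riesz_sequence_eps ::
  "real \<Rightarrow> 'i set \<Rightarrow> ('i \<Rightarrow> 'h::complex_inner) \<Rightarrow> bool" where
  "riesz_sequence_eps \<epsilon> J g \<longleftrightarrow>
     (\<exists>A>0. \<forall>c::'i \<Rightarrow> complex. (\<lambda>i. (cmod (c i))\<^sup>2) summable_on J \<longrightarrow>
       (\<lambda>i. c i *\<^sub>C g i) summable_on J \<and>
       (1 - \<epsilon>) * A * (\<Sum>\<^sub>\<infinity>i\<in>J. (cmod (c i))\<^sup>2) \<le> (norm (\<Sum>\<^sub>\<infinity>i\<in>J. c i *\<^sub>C g i))\<^sup>2 \<and>
       (norm (\<Sum>\<^sub>\<infinity>i\<in>J. c i *\<^sub>C g i))\<^sup>2 \<le> (1 + \<epsilon>) * A * (\<Sum>\<^sub>\<infinity>i\<in>J. (cmod (c i))\<^sup>2))"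

end

theory Submission
  imports Defs
begin

text \<open>
  The Gram matrix of a suitable subfamily is a small perturbation of a multiple of the identity, and
  such a subfamily is an \<open>\<epsilon>\<close>-Riesz sequence. Two perturbations have to be made small.

  Off the diagonal, the entry at \<open>(i, j)\<close> is bounded by \<open>r\<close> at the difference \<open>a i - a j\<close>, with \<open>r\<close>
  summable over the group. Outside a finite set \<open>E\<close> of differences, containing the neutral element,
  the sum of \<open>\<bar>r\<bar>\<close> is tiny. Finite upper density bounds the fibres of \<open>a\<close> uniformly
  (\<open>bounded_fibres_of_finite_density\<close>), so the graph joining \<open>i\<close> and \<open>j\<close> whenever
  \<open>a i - a j\<close> or \<open>a j - a i\<close> lies in \<open>E\<close> has bounded degree, and a greedy colouring needs only
  finitely many colours (\<open>bounded_degree_colouring\<close>). Within one colour \<open>a\<close> is injective and no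
  difference of distinct indices lies in \<open>E\<close>; hence each row of the Gram matrix has a small
  off-diagonal sum (\<open>colouring_with_small_correlations\<close>).

  On the diagonal, the numbers \<open>(norm (f i))\<^sup>2\<close> lie between \<open>\<epsilon>\<^sup>2\<close> and the value of \<open>r\<close> at the
  neutral element. Cutting this bounded range into finitely many short intervals makes the
  diagonal almost constant on each piece.

  The Schur test (\<open>finite_sum_norm_bounds\<close>) turns both estimates into the Riesz bounds for finite
  sums, and completeness extends them to square-summable coefficients
  (\<open>riesz_sequence_eps_of_finite_bounds\<close>).
\<close>

section \<open>Greedy colouring of countable graphs\<close>

text \<open>
  Vertices are coloured in the order of an enumeration, each with a colour that none of its earlier
  neighbours carries: at most \<open>D\<close> of the \<open>D + 1\<close> colours are blocked.
\<close>
lemma bounded_degree_colouring: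
  fixes R :: "'i \<Rightarrow> 'i \<Rightarrow> bool"
  assumes "countable I"
    and sym: "\<And>i j. R i j \<Longrightarrow> R j i"
    and fin: "\<And>i. i \<in> I \<Longrightarrow> finite {j\<in>I. R i j}"
    and deg: "\<And>i. i \<in> I \<Longrightarrow> card {j\<in>I. R i j} \<le> D"
  obtains col :: "'i \<Rightarrow> nat"
  where "col ` I \<subseteq> {..D}"
    and "\<And>i j. \<lbrakk>i \<in> I; j \<in> I; i \<noteq> j; R i j\<rbrakk> \<Longrightarrow> col i \<noteq> col j"
proof -
  define pos where "pos = to_nat_on I"
  have inj: "inj_on pos I"
    unfolding pos_def by (rule inj_on_to_nat_on[OF assms(1)])
  define P where "P = (\<lambda>(col::'i \<Rightarrow> nat) i c. i \<in> I \<longrightarrow>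
    c \<le> D \<and> (\<forall>j\<in>I. R i j \<and> pos j < pos i \<longrightarrow> c \<noteq> col j))"
  have "\<exists>col. \<forall>i. P col i (col i)"
  proof (rule dependent_wf_choice[where R = "inv_image less_than pos"])
    show "P f x c = P g x c" if that_eq: "\<And>z. (z, x) \<in> inv_image less_than pos \<Longrightarrow> f z = g z" for f g x c
    proof -
      have "f j = g j" if "pos j < pos x" for j
        using that that_eq by simp
      then show ?thesis
        by (simp add: P_def cong: conj_cong)
    qed
  next
    fix i and col :: "'i \<Rightarrow> nat"
    show "\<exists>c. P col i c"
    proof (cases "i \<in> I")
      case True
      have "card (col ` {j\<in>I. R i j}) \<le> D"
        using card_image_le[OF fin[OF True], of col] deg[OF True] by linarith
      then have "\<not> {..D} \<subseteq> col ` {j\<in>I. R i j}"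
        using card_mono[OF finite_imageI[OF fin[OF True]], of "{..D}" col] by auto
      then obtain c where "c \<le> D" "c \<notin> col ` {j\<in>I. R i j}"
        by auto
      then show ?thesis
        by (intro exI[of _ c]) (auto simp: P_def)
    qed (simp add: P_def)
  qed auto
  then obtain col where col: "P col i (col i)" for i
    by auto
  show thesis
  proof
    show "col ` I \<subseteq> {..D}"
    proof (rule image_subsetI)
      fix i assume "i \<in> I"
      then show "col i \<in> {..D}"
        using col[of i] by (simp add: P_def)
    qed
    fix i j assume ij: "i \<in> I" "j \<in> I" "i \<noteq> j" "R i j"
    then have "pos i \<noteq> pos j"
      by (simp add: inj_on_eq_iff[OF inj])
    then consider "pos i < pos j" | "pos j < pos i"
      by linarith
    then show "col i \<noteq> col j"
    proof cases
      case 1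
      then show ?thesis
        using col[of j] ij sym[OF ij(4)] by (auto simp: P_def dest!: bspec[where x = i])
    next
      case 2
      then show ?thesis
        using col[of i] ij by (auto simp: P_def dest!: bspec[where x = j])
    qed
  qed
qed

section \<open>Finite upper density bounds the fibres\<close>

lemma (in group) card_group_box:
  assumes "j \<in> carrier G"
  shows "card (group_box G nrm N j) = card (group_box G nrm N \<one>)"
proof -
  have "bij_betw (\<lambda>k. k \<otimes> j) (group_box G nrm N \<one>) (group_box G nrm N j)"
    by (rule bij_betw_byWitness[where f' = "\<lambda>k. k \<otimes> inv j"])
      (use assms in \<open>auto simp: group_box_def m_assoc\<close>)
  then show ?thesis
    by (simp add: bij_betw_same_card)
qed

text \<open>
  If the limsup is finite, then at some scale \<open>N\<close> the supremum of the ratios is finite. All boxes at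
  scale \<open>N\<close> are translates of one another, so the numbers of indices in them are bounded uniformly;
  and the box around \<open>g\<close> contains \<open>g\<close>.
\<close>
lemma (in group) bounded_fibres_of_finite_density:
  assumes "nrm \<one> \<le> 0" and "upper_density G nrm I a < \<infinity>"
  obtains K where "\<And>g. g \<in> carrier G \<Longrightarrow> finite {i\<in>I. a i = g}"
    and "\<And>g. g \<in> carrier G \<Longrightarrow> card {i\<in>I. a i = g} \<le> K"
proof -
  let ?X = "\<lambda>N j. {i\<in>I. a i \<in> group_box G nrm N j}"
  obtain N where N: "(SUP j\<in>carrier G. emeasure (count_space I) (?X N j) /
       of_nat (card (group_box G nrm N j))) < \<infinity>" (is "?S < _")
    using eventually_happens'[OF sequentially_bot Limsup_lessD[OF assms(2)[unfolded upper_density_def]]]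
    by auto
  define C where "C = ?S * of_nat (card (group_box G nrm N \<one>))"
  have C: "C < \<infinity>"
    using N by (simp add: C_def ennreal_mult_less_top of_nat_less_top)
  have X: "emeasure (count_space I) (?X N g) \<le> C" if g: "g \<in> carrier G" for g
  proof -
    have le: "emeasure (count_space I) (?X N g) / of_nat (card (group_box G nrm N g)) \<le> ?S"
      by (rule SUP_upper[OF g])
    \<comment> \<open>An infinite box has \<open>card\<close> equal to 0; a finite ratio then forces the numerator to vanish.\<close>
    show ?thesis
    proof (cases "card (group_box G nrm N g) = 0")
      case True
      then have "emeasure (count_space I) (?X N g) = 0"
        using le_less_trans[OF le N] True by (auto split: if_splits)
      then show ?thesis by simp
    next
      case False
      have "emeasure (count_space I) (?X N g) =
          emeasure (count_space I) (?X N g) / of_nat (card (group_box G nrm N g)) *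
          of_nat (card (group_box G nrm N g))"
        using False by (simp add: ennreal_divide_times ennreal_divide_self of_nat_less_top)
      also have "\<dots> \<le> C"
        unfolding C_def card_group_box[OF g] using le by (simp add: card_group_box[OF g] mult_right_mono)
      finally show ?thesis .
    qed
  qed
  have fin: "finite (?X N g)" and card: "card (?X N g) \<le> nat \<lfloor>enn2real C\<rfloor>"
    if g: "g \<in> carrier G" for g
  proof -
    show fin: "finite (?X N g)"
      using X[OF g] C by (cases "finite (?X N g)") (auto simp: emeasure_count_space top_unique)
    have "ennreal (real (card (?X N g))) \<le> ennreal (enn2real C)"
      using X[OF g] C fin by (auto simp: emeasure_count_space ennreal_of_nat_eq_real_of_nat)
    then have "real (card (?X N g)) \<le> enn2real C"
      by (subst (asm) ennreal_le_iff) auto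
    then show "card (?X N g) \<le> nat \<lfloor>enn2real C\<rfloor>"
      by (simp add: le_nat_floor)
  qed
  have sub: "{i\<in>I. a i = g} \<subseteq> ?X N g" if "g \<in> carrier G" for g
    using that assms(1) by (auto simp: group_box_def)
  show thesis
  proof (rule that)
    fix g assume g: "g \<in> carrier G"
    show "finite {i\<in>I. a i = g}"
      by (rule finite_subset[OF sub[OF g] fin[OF g]])
    show "card {i\<in>I. a i = g} \<le> nat \<lfloor>enn2real C\<rfloor>"
      by (rule order_trans[OF card_mono[OF fin[OF g] sub[OF g]] card[OF g]])
  qed
qed

section \<open>Splitting off small off-diagonal sums\<close>

lemma summable_on_tails_small:
  fixes f :: "'a \<Rightarrow> real"
  assumes "f summable_on A" and nonneg: "\<And>x. x \<in> A \<Longrightarrow> 0 \<le> f x" and "0 < e"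
  obtains F where "finite F" "F \<subseteq> A" "\<And>Y. \<lbrakk>finite Y; Y \<subseteq> A - F\<rbrakk> \<Longrightarrow> sum f Y \<le> e"
proof -
  obtain F where F: "finite F" "F \<subseteq> A" "dist (sum f F) (infsum f A) \<le> e"
    using infsum_finite_approximation[OF assms(1,3)] by blast
  have "sum f Y \<le> e" if Y: "finite Y" "Y \<subseteq> A - F" for Y
  proof -
    have "sum f (F \<union> Y) \<le> infsum f A"
      by (rule finite_sum_le_infsum) (use assms(1) nonneg F Y in auto)
    moreover have "sum f (F \<union> Y) = sum f F + sum f Y"
      by (rule sum.union_disjoint) (use F Y in auto)
    ultimately show ?thesis
      using F(3) by (simp add: dist_real_def)
  qed
  with F(1,2) show thesis by (rule that)
qed

text \<open>
  Along a row, the correlations are dominated by values of \<open>r\<close> at differences. Within one colour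
  these differences are pairwise distinct and avoid the finite set that carries almost all of the
  mass of \<open>r\<close>, so the row sum is at most a tail of \<open>r\<close>.
\<close>
lemma (in group) colouring_with_small_correlations:
  fixes f :: "'i \<Rightarrow> 'h::complex_inner"
  assumes "countable I" and a: "a \<in> I \<rightarrow> carrier G"
    and loc: "l1_self_localized G I f a"
    and fin: "\<And>g. g \<in> carrier G \<Longrightarrow> finite {i\<in>I. a i = g}"
    and card: "\<And>g. g \<in> carrier G \<Longrightarrow> card {i\<in>I. a i = g} \<le> K"
    and "0 < \<eta>"
  obtains col :: "'i \<Rightarrow> nat"
  where "finite (col ` I)"
    and "\<And>i X. \<lbrakk>i \<in> I; finite X; X \<subseteq> I; i \<notin> X; \<And>j. j \<in> X \<Longrightarrow> col j = col i\<rbrakk>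
           \<Longrightarrow> (\<Sum>j\<in>X. cmod (cinner (f i) (f j))) \<le> \<eta>"
proof -
  obtain r :: "'a \<Rightarrow> real" where r: "(\<lambda>g. \<bar>r g\<bar>) summable_on carrier G"
    and fr: "\<And>i j. \<lbrakk>i \<in> I; j \<in> I\<rbrakk> \<Longrightarrow> cmod (cinner (f i) (f j)) \<le> r (a i \<otimes> inv a j)"
    using loc unfolding l1_self_localized_def by blast
  obtain F where F: "finite F" "F \<subseteq> carrier G"
    and tail: "\<And>Y. \<lbrakk>finite Y; Y \<subseteq> carrier G - F\<rbrakk> \<Longrightarrow> (\<Sum>g\<in>Y. \<bar>r g\<bar>) \<le> \<eta>"
    using summable_on_tails_small[OF r _ \<open>0 < \<eta>\<close>] by auto
  \<comment> \<open>Adding the neutral element forces indices in the same fibre of \<open>a\<close> to receive different colours.\<close>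
  define E where "E = insert \<one> F"
  have E: "finite E" "E \<subseteq> carrier G" "\<one> \<in> E" "F \<subseteq> E"
    using F by (auto simp: E_def)
  define R where "R = (\<lambda>i j. a i \<otimes> inv a j \<in> E \<or> a j \<otimes> inv a i \<in> E)"
  have nbrs: "finite {j\<in>I. R i j} \<and> card {j\<in>I. R i j} \<le> (card E + card E) * K"
    if i: "i \<in> I" for i
  proof -
    \<comment> \<open>A neighbour of \<open>i\<close> lies over one of the at most \<open>2 * card E\<close> points of \<open>?B\<close>.\<close>
    let ?B = "(\<lambda>h. inv h \<otimes> a i) ` E \<union> (\<lambda>h. h \<otimes> a i) ` E"
    have ai: "a i \<in> carrier G" using a i by auto
    have B: "finite ?B" "?B \<subseteq> carrier G"
      using E ai by auto
    have "j \<in> (\<Union>g\<in>?B. {j\<in>I. a j = g})" if j: "j \<in> I" "R i j" for j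
    proof -
      have aj: "a j \<in> carrier G" using a j by auto
      have "a j = inv (a i \<otimes> inv a j) \<otimes> a i" "a j = (a j \<otimes> inv a i) \<otimes> a i"
        using ai aj by (simp_all add: inv_mult_group m_assoc)
      then show ?thesis
        using j unfolding R_def by blast
    qed
    then have sub: "{j\<in>I. R i j} \<subseteq> (\<Union>g\<in>?B. {j\<in>I. a j = g})"
      by blast
    have finU: "finite (\<Union>g\<in>?B. {j\<in>I. a j = g})"
      by (rule finite_UN_I[OF B(1)]) (use fin B(2) in blast)
    have "card {j\<in>I. R i j} \<le> card (\<Union>g\<in>?B. {j\<in>I. a j = g})"
      by (rule card_mono[OF finU sub])
    also have "\<dots> \<le> (\<Sum>g\<in>?B. card {j\<in>I. a j = g})"
      by (rule card_UN_le[OF B(1)])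
    also have "\<dots> \<le> of_nat (card ?B) * K"
      by (rule sum_bounded_above) (use card B(2) in blast)
    also have "\<dots> \<le> (card E + card E) * K"
      using card_Un_le[of "(\<lambda>h. inv h \<otimes> a i) ` E" "(\<lambda>h. h \<otimes> a i) ` E"]
        card_image_le[OF E(1), of "\<lambda>h. inv h \<otimes> a i"] card_image_le[OF E(1), of "\<lambda>h. h \<otimes> a i"]
      by (intro mult_right_mono) auto
    finally show ?thesis
      using finite_subset[OF sub finU] by simp
  qed
  obtain col :: "'i \<Rightarrow> nat" where col: "col ` I \<subseteq> {..(card E + card E) * K}"
    and proper: "\<And>i j. \<lbrakk>i \<in> I; j \<in> I; i \<noteq> j; R i j\<rbrakk> \<Longrightarrow> col i \<noteq> col j"
    using bounded_degree_colouring[OF assms(1), of R "(card E + card E) * K"] nbrs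
    by (auto simp: R_def)
  show thesis
  proof
    show "finite (col ` I)"
      using col finite_subset by blast
    fix i X assume i: "i \<in> I" and X: "finite X" "X \<subseteq> I" "i \<notin> X"
      and mono: "\<And>j. j \<in> X \<Longrightarrow> col j = col i"
    let ?d = "\<lambda>j. a i \<otimes> inv a j"
    have ac: "a j \<in> carrier G" if "j \<in> insert i X" for j
      using a i X that by auto
    have sep: "a j \<otimes> inv a k \<notin> E" if "j \<in> insert i X" "k \<in> insert i X" "j \<noteq> k" for j k
    proof
      assume "a j \<otimes> inv a k \<in> E"
      then have "R j k" by (simp add: R_def)
      moreover have "j \<in> I" "k \<in> I" using that i X(2) by auto
      ultimately have "col j \<noteq> col k" using that(3) by (intro proper)
      moreover have "col j = col i" "col k = col i" using that mono by auto
      ultimately show False by simp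
    qed
    have inj: "inj_on ?d X"
    proof (rule inj_onI, rule ccontr)
      fix j k assume jk: "j \<in> X" "k \<in> X" "?d j = ?d k" "j \<noteq> k"
      have rec: "a l = inv ?d l \<otimes> a i" if "l \<in> X" for l
        using ac[of i] ac[of l] that by (simp add: inv_mult_group m_assoc)
      have "a j = a k"
        using rec[OF jk(1)] rec[OF jk(2)] jk(3) by simp
      then show False
        using sep[of j k] jk ac[of k] E(3) by (simp add: r_inv)
    qed
    have "(\<Sum>j\<in>X. cmod (cinner (f i) (f j))) \<le> (\<Sum>j\<in>X. \<bar>r (?d j)\<bar>)"
      by (rule sum_mono) (use fr i X in force)
    also have "\<dots> = (\<Sum>g\<in>?d ` X. \<bar>r g\<bar>)"
      by (simp add: sum.reindex[OF inj])
    also have "\<dots> \<le> \<eta>"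
      using sep[of i] X E(4) ac by (intro tail) auto
    finally show "(\<Sum>j\<in>X. cmod (cinner (f i) (f j))) \<le> \<eta>" .
  qed
qed

section \<open>Diagonally dominant Gram matrices\<close>

lemma cinner_zero_left [simp]: "cinner 0 (y::'h::complex_inner) = 0"
  using cinner_add_left[of 0 0 y] by simp

lemma cinner_sum_left: "cinner (\<Sum>i\<in>X. u i) (y::'h::complex_inner) = (\<Sum>i\<in>X. cinner (u i) y)"
  by (induction X rule: infinite_finite_induct) (simp_all add: cinner_add_left)

lemma cinner_sum_right: "cinner (y::'h::complex_inner) (\<Sum>i\<in>X. u i) = (\<Sum>i\<in>X. cinner y (u i))"
proof -
  have "cinner y (\<Sum>i\<in>X. u i) = cnj (cinner (\<Sum>i\<in>X. u i) y)"
    by (rule cinner_commute)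
  also have "\<dots> = (\<Sum>i\<in>X. cnj (cinner (u i) y))"
    by (simp add: cinner_sum_left)
  also have "\<dots> = (\<Sum>i\<in>X. cinner y (u i))"
    by (rule sum.cong[OF refl]) (rule cinner_commute[symmetric])
  finally show ?thesis .
qed

lemma cinner_scaleC_right: "cinner (x::'h::complex_inner) (c *\<^sub>C y) = cnj c * cinner x y"
proof -
  have "cinner x (c *\<^sub>C y) = cnj (cinner (c *\<^sub>C y) x)"
    by (rule cinner_commute)
  also have "\<dots> = cnj c * cnj (cinner y x)"
    by (simp add: cinner_scaleC_left)
  also have "cnj (cinner y x) = cinner x y"
    by (rule cinner_commute[symmetric])
  finally show ?thesis .
qed

lemma cmod_cinner_commute: "cmod (cinner (x::'h::complex_inner) y) = cmod (cinner y x)"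
  by (subst cinner_commute) simp

text \<open>
  This is the Schur test for the Gram matrix \<open>\<Gamma>\<close> minus \<open>A\<close> times the identity. The diagonal
  contributes at most \<open>\<delta>\<close> times the squared norm of \<open>c\<close>. By
  \<open>2 * \<bar>c i\<bar> * \<bar>c j\<bar> \<le> \<bar>c i\<bar>\<^sup>2 + \<bar>c j\<bar>\<^sup>2\<close> and the symmetry of \<open>\<bar>\<Gamma> i j\<bar>\<close>, the off-diagonal part of
  the quadratic form is at most \<open>\<eta>\<close> times that squared norm.
\<close>
lemma finite_sum_norm_bounds:
  fixes f :: "'i \<Rightarrow> 'h::complex_inner"
  assumes "finite X"
    and diag: "\<And>i. i \<in> X \<Longrightarrow> \<bar>(norm (f i))\<^sup>2 - A\<bar> \<le> \<delta>"
    and off: "\<And>i. i \<in> X \<Longrightarrow> (\<Sum>j\<in>X - {i}. cmod (cinner (f i) (f j))) \<le> \<eta>"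
  shows "\<bar>(norm (\<Sum>i\<in>X. c i *\<^sub>C f i))\<^sup>2 - A * (\<Sum>i\<in>X. (cmod (c i))\<^sup>2)\<bar>
    \<le> (\<delta> + \<eta>) * (\<Sum>i\<in>X. (cmod (c i))\<^sup>2)"
proof -
  let ?g = "\<lambda>i j. c i * cnj (c j) * cinner (f i) (f j)"
  let ?m = "\<lambda>i j. cmod (cinner (f i) (f j))"
  let ?q = "\<lambda>i. (cmod (c i))\<^sup>2"
  have diag_term: "?g i i = of_real (?q i * (norm (f i))\<^sup>2)" for i
    by (simp only: cinner_self complex_norm_square[symmetric] of_real_mult)
  have "of_real ((norm (\<Sum>i\<in>X. c i *\<^sub>C f i))\<^sup>2) =
      cinner (\<Sum>i\<in>X. c i *\<^sub>C f i) (\<Sum>i\<in>X. c i *\<^sub>C f i)"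
    by (rule cinner_self[symmetric])
  also have "\<dots> = (\<Sum>i\<in>X. \<Sum>j\<in>X. ?g i j)"
    unfolding cinner_sum_left
    by (simp add: cinner_sum_right cinner_scaleC_left cinner_scaleC_right sum_distrib_left mult_ac)
  also have "\<dots> = (\<Sum>i\<in>X. ?g i i + (\<Sum>j\<in>X - {i}. ?g i j))"
    by (rule sum.cong[OF refl]) (rule sum.remove[OF assms(1)])
  also have "\<dots> = of_real (\<Sum>i\<in>X. ?q i * (norm (f i))\<^sup>2) + (\<Sum>i\<in>X. \<Sum>j\<in>X - {i}. ?g i j)"
    by (simp only: sum.distrib diag_term of_real_sum)
  finally have "of_real ((norm (\<Sum>i\<in>X. c i *\<^sub>C f i))\<^sup>2 - (\<Sum>i\<in>X. ?q i * (norm (f i))\<^sup>2))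
      = (\<Sum>i\<in>X. \<Sum>j\<in>X - {i}. ?g i j)"
    by (simp only: of_real_diff add_diff_cancel_left')
  from arg_cong[OF this, of cmod]
  have "\<bar>(norm (\<Sum>i\<in>X. c i *\<^sub>C f i))\<^sup>2 - (\<Sum>i\<in>X. ?q i * (norm (f i))\<^sup>2)\<bar>
      = cmod (\<Sum>i\<in>X. \<Sum>j\<in>X - {i}. ?g i j)"
    by (simp only: norm_of_real)
  also have "\<dots> \<le> (\<Sum>i\<in>X. \<Sum>j\<in>X - {i}. (?q i * ?m i j + ?q j * ?m i j) / 2)"
  proof (intro order_trans[OF norm_sum] sum_mono)
    fix i j
    have "2 * (cmod (c i) * cmod (c j)) \<le> ?q i + ?q j"
      using sum_squares_bound[of "cmod (c i)" "cmod (c j)"] by (simp add: mult_ac)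
    then have "(cmod (c i) * cmod (c j)) * ?m i j \<le> ((?q i + ?q j) / 2) * ?m i j"
      by (intro mult_right_mono) auto
    then show "norm (?g i j) \<le> (?q i * ?m i j + ?q j * ?m i j) / 2"
      by (simp add: norm_mult algebra_simps)
  qed
  also have "\<dots> = ((\<Sum>i\<in>X. \<Sum>j\<in>X - {i}. ?q i * ?m i j) +
      (\<Sum>i\<in>X. \<Sum>j\<in>X - {i}. ?q j * ?m i j)) / 2"
    by (simp add: sum.distrib flip: sum_divide_distrib)
  also have "(\<Sum>i\<in>X. \<Sum>j\<in>X - {i}. ?q j * ?m i j) = (\<Sum>j\<in>X. \<Sum>i\<in>X - {j}. ?q j * ?m j i)"
  proof -
    have "(\<Sum>i\<in>X. \<Sum>j\<in>X - {i}. ?q j * ?m i j) =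
        (\<Sum>i\<in>X. \<Sum>j | j \<in> X \<and> j \<noteq> i. ?q j * ?m i j)"
      by (intro sum.cong) auto
    also have "\<dots> = (\<Sum>j\<in>X. \<Sum>i | i \<in> X \<and> j \<noteq> i. ?q j * ?m i j)"
      by (rule sum.swap_restrict) (use assms(1) in auto)
    also have "\<dots> = (\<Sum>j\<in>X. \<Sum>i\<in>X - {j}. ?q j * ?m j i)"
      by (intro sum.cong) (auto simp: cmod_cinner_commute)
    finally show ?thesis .
  qed
  also have "((\<Sum>i\<in>X. \<Sum>j\<in>X - {i}. ?q i * ?m i j) +
      (\<Sum>i\<in>X. \<Sum>j\<in>X - {i}. ?q i * ?m i j)) / 2 = (\<Sum>i\<in>X. ?q i * (\<Sum>j\<in>X - {i}. ?m i j))"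
    by (simp flip: sum_distrib_left)
  also have "\<dots> \<le> (\<Sum>i\<in>X. ?q i * \<eta>)"
    by (intro sum_mono mult_left_mono off) auto
  finally have off_part: "\<bar>(norm (\<Sum>i\<in>X. c i *\<^sub>C f i))\<^sup>2 - (\<Sum>i\<in>X. ?q i * (norm (f i))\<^sup>2)\<bar>
      \<le> \<eta> * (\<Sum>i\<in>X. ?q i)"
    by (simp add: sum_distrib_left mult_ac)
  have "\<bar>(\<Sum>i\<in>X. ?q i * (norm (f i))\<^sup>2) - A * (\<Sum>i\<in>X. ?q i)\<bar>
      = \<bar>\<Sum>i\<in>X. ?q i * ((norm (f i))\<^sup>2 - A)\<bar>"
    by (simp add: sum_distrib_left sum_subtractf algebra_simps)
  also have "\<dots> \<le> (\<Sum>i\<in>X. ?q i * \<bar>(norm (f i))\<^sup>2 - A\<bar>)"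
    by (rule order_trans[OF sum_abs]) (simp add: abs_mult)
  also have "\<dots> \<le> (\<Sum>i\<in>X. ?q i * \<delta>)"
    by (intro sum_mono mult_left_mono diag) auto
  finally have "\<bar>(\<Sum>i\<in>X. ?q i * (norm (f i))\<^sup>2) - A * (\<Sum>i\<in>X. ?q i)\<bar> \<le> \<delta> * (\<Sum>i\<in>X. ?q i)"
    by (simp add: sum_distrib_left mult_ac)
  with off_part show ?thesis
    by (simp add: distrib_right)
qed

section \<open>Passing to infinite sums\<close>

text \<open>The Cauchy criterion for unconditional summability in a complete normed space.\<close>
lemma summable_on_if_tails_small:
  fixes u :: "'i \<Rightarrow> 'h::{real_normed_vector,complete_space}"
  assumes "\<And>e. 0 < e \<Longrightarrow> \<exists>F. finite F \<and> F \<subseteq> A \<and> (\<forall>Y. finite Y \<and> Y \<subseteq> A - F \<longrightarrow> norm (sum u Y) < e)"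
  shows "u summable_on A"
proof -
  have "\<exists>P. eventually P (finite_subsets_at_top A) \<and>
      (\<forall>F F'. P F \<and> P F' \<longrightarrow> dist (sum u F) (sum u F') < e)" if e: "0 < e" for e
  proof -
    obtain F0 where F0: "finite F0" "F0 \<subseteq> A"
      and small: "\<And>Y. finite Y \<Longrightarrow> Y \<subseteq> A - F0 \<Longrightarrow> norm (sum u Y) < e / 2"
      using assms[of "e / 2"] e by auto
    have near: "dist (sum u F) (sum u F0) < e / 2" if "finite F" "F0 \<subseteq> F" "F \<subseteq> A" for F
      using small[of "F - F0"] that by (auto simp: dist_norm sum_diff)
    show ?thesis
    proof (intro exI conjI allI impI)
      show "eventually (\<lambda>F. finite F \<and> F0 \<subseteq> F \<and> F \<subseteq> A) (finite_subsets_at_top A)"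
        unfolding eventually_finite_subsets_at_top using F0 by blast
      fix F F' assume "(finite F \<and> F0 \<subseteq> F \<and> F \<subseteq> A) \<and> (finite F' \<and> F0 \<subseteq> F' \<and> F' \<subseteq> A)"
      then show "dist (sum u F) (sum u F') < e"
        using dist_triangle_half_l[of "sum u F" "sum u F0" e "sum u F'"] near[of F] near[of F'] 
        by (simp add: dist_commute)
    qed
  qed
  then have "cauchy_filter (filtermap (sum u) (finite_subsets_at_top A))"
    by (simp add: cauchy_filter_metric_filtermap)
  moreover have "complete (UNIV :: 'h set)"
    by (meson Cauchy_convergent UNIV_I complete_def convergent_def)
  ultimately obtain L where "(sum u \<longlongrightarrow> L) (finite_subsets_at_top A)"
    using complete_uniform[where S = UNIV] by (force simp: filterlim_def)
  then show ?thesis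
    using summable_on_def has_sum_def by blast
qed

text \<open>
  Applied to finite sets far out in \<open>J\<close>, the upper bound makes the partial sums of \<open>c i *\<^sub>C f i\<close>
  a Cauchy net; both bounds then survive the limit along finite subsets.
\<close>
lemma riesz_sequence_eps_of_finite_bounds:
  fixes f :: "'i \<Rightarrow> 'h::chilbert_space"
  assumes "0 < A"
    and bounds: "\<And>X c. \<lbrakk>finite X; X \<subseteq> J\<rbrakk> \<Longrightarrow>
      \<bar>(norm (\<Sum>i\<in>X. c i *\<^sub>C f i))\<^sup>2 - A * (\<Sum>i\<in>X. (cmod (c i))\<^sup>2)\<bar>
        \<le> \<epsilon> * A * (\<Sum>i\<in>X. (cmod (c i))\<^sup>2)"
  shows "riesz_sequence_eps \<epsilon> J f"
  unfolding riesz_sequence_eps_def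
proof (intro exI conjI allI impI)
  show "A > 0" by fact
  fix c :: "'i \<Rightarrow> complex"
  let ?q = "\<lambda>i. (cmod (c i))\<^sup>2"
  let ?u = "\<lambda>i. c i *\<^sub>C f i"
  assume q: "?q summable_on J"
  have lower: "(1 - \<epsilon>) * A * (\<Sum>i\<in>X. ?q i) \<le> (norm (\<Sum>i\<in>X. ?u i))\<^sup>2"
    and upper: "(norm (\<Sum>i\<in>X. ?u i))\<^sup>2 \<le> (1 + \<epsilon>) * A * (\<Sum>i\<in>X. ?q i)"
    if "finite X" "X \<subseteq> J" for X
    using bounds[OF that, of c] by (auto simp: algebra_simps abs_le_iff)
  show u: "?u summable_on J"
  proof (rule summable_on_if_tails_small)
    fix e :: real assume e: "0 < e"
    \<comment> \<open>A positive constant above \<open>(1 + \<epsilon>) * A\<close>, so that it may be divided by.\<close>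
    define B where "B = \<bar>(1 + \<epsilon>) * A\<bar> + 1"
    have B: "0 < B" "(1 + \<epsilon>) * A \<le> B" by (auto simp: B_def)
    obtain F where F: "finite F" "F \<subseteq> J"
      and tail: "\<And>Y. \<lbrakk>finite Y; Y \<subseteq> J - F\<rbrakk> \<Longrightarrow> (\<Sum>i\<in>Y. ?q i) \<le> (e / 2)\<^sup>2 / B"
      using summable_on_tails_small[OF q, of "(e / 2)\<^sup>2 / B"] e B by auto
    have "norm (sum ?u Y) < e" if Y: "finite Y" "Y \<subseteq> J - F" for Y
    proof -
      have "(norm (sum ?u Y))\<^sup>2 \<le> (1 + \<epsilon>) * A * (\<Sum>i\<in>Y. ?q i)"
        by (rule upper) (use Y in auto)
      also have "\<dots> \<le> B * (\<Sum>i\<in>Y. ?q i)"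
        by (intro mult_right_mono B sum_nonneg) auto
      also have "\<dots> \<le> (e / 2)\<^sup>2"
        using tail[OF Y] B by (simp add: field_simps)
      finally have "norm (sum ?u Y) \<le> e / 2"
        using e by (simp add: power2_le_iff_abs_le)
      with e show ?thesis by linarith
    qed
    with F show "\<exists>F. finite F \<and> F \<subseteq> J \<and> (\<forall>Y. finite Y \<and> Y \<subseteq> J - F \<longrightarrow> norm (sum ?u Y) < e)"
      by blast
  qed
  have lim_q: "((\<lambda>X. C * (\<Sum>i\<in>X. ?q i)) \<longlongrightarrow> C * infsum ?q J) (finite_subsets_at_top J)" for C
    by (intro tendsto_intros infsum_tendsto q)
  have lim_u: "((\<lambda>X. (norm (\<Sum>i\<in>X. ?u i))\<^sup>2) \<longlongrightarrow> (norm (infsum ?u J))\<^sup>2) (finite_subsets_at_top J)"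
    by (intro tendsto_intros infsum_tendsto u)
  show "(1 - \<epsilon>) * A * infsum ?q J \<le> (norm (infsum ?u J))\<^sup>2"
    by (rule tendsto_le[OF finite_subsets_at_top_neq_bot lim_u lim_q])
      (auto intro!: eventually_finite_subsets_at_top_weakI lower)
  show "(norm (infsum ?u J))\<^sup>2 \<le> (1 + \<epsilon>) * A * infsum ?q J"
    by (rule tendsto_le[OF finite_subsets_at_top_neq_bot lim_q lim_u])
      (auto intro!: eventually_finite_subsets_at_top_weakI upper)
qed

section \<open>The lattice groups and the decomposition\<close>

lemma group_multiples_group: "group (multiples_group x)"
proof (rule groupI)
  fix u assume "u \<in> carrier (multiples_group x)"
  then obtain k :: int where "u = x * of_int k"
    by (auto simp: multiples_group_def)
  then show "\<exists>v\<in>carrier (multiples_group x). v \<otimes>\<^bsub>multiples_group x\<^esub> u = \<one>\<^bsub>multiples_group x\<^esub>"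
    by (intro bexI[of _ "x * of_int (- k)"]) (auto simp: multiples_group_def intro: image_eqI[of _ _ "- k"])
next
  show "\<one>\<^bsub>multiples_group x\<^esub> \<in> carrier (multiples_group x)"
    by (auto simp: multiples_group_def intro: image_eqI[of _ _ 0])
next
  fix u v assume "u \<in> carrier (multiples_group x)" "v \<in> carrier (multiples_group x)"
  then obtain k l :: int where "u = x * of_int k" "v = x * of_int l"
    by (auto simp: multiples_group_def)
  then have "u + v = x * of_int (k + l)"
    by (simp add: distrib_left)
  then have "u + v \<in> range (\<lambda>k::int. x * of_int k)"
    by (rule range_eqI)
  then show "u \<otimes>\<^bsub>multiples_group x\<^esub> v \<in> carrier (multiples_group x)"
    by (simp add: multiples_group_def)
qed (auto simp: multiples_group_def)

lemma group_lattice_group: "group (lattice_group d \<alpha> e n)"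
  unfolding lattice_group_def
  by (intro DirProd_group) (auto simp: group_multiples_group)

lemma lattice_abs_one:
  assumes "d \<ge> 1"
  shows "lattice_abs d e \<one>\<^bsub>lattice_group d \<alpha> e n\<^esub> = 0"
proof -
  have "\<exists>i. i < d"
    using assms by (intro exI[of _ 0]) simp
  then have "(\<lambda>i. \<bar>fst \<one>\<^bsub>lattice_group d \<alpha> e n\<^esub> i\<bar>) ` {..<d} \<union>
      (\<lambda>j. if snd \<one>\<^bsub>lattice_group d \<alpha> e n\<^esub> j = 0 then 0 else 1) ` {..<e} = {0}"
    by (auto simp: lattice_group_def multiples_group_def image_iff Bex_def)
  then show ?thesis
    unfolding lattice_abs_def by simp
qed

lemma partition_on_fibres:
  "partition_on I ((\<lambda>v. {i\<in>I. h i = v}) ` h ` I)"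
  by (auto simp: partition_on_def disjoint_def)

theorem theorem3p11:
  fixes f :: "'i \<Rightarrow> 'h::chilbert_space"
    and I :: "'i set"
    and d e :: nat
    and \<alpha> :: "nat \<Rightarrow> real"
    and n :: "nat \<Rightarrow> nat"
    and a :: "'i \<Rightarrow> (nat \<Rightarrow> real) \<times> (nat \<Rightarrow> int)"
    and \<epsilon> :: real
  defines "G \<equiv> lattice_group d \<alpha> e n"
  assumes "separable_space (euclidean :: 'h topology)"
    and "countable I"
    and "d \<ge> 1" and "\<And>i. i < d \<Longrightarrow> \<alpha> i > 0" and "\<And>j. j < e \<Longrightarrow> n j \<ge> 1"
    and "a \<in> I \<rightarrow> carrier G"
    and "l1_self_localized G I f a"
    and "upper_density G (lattice_abs d e) I a < \<infinity>"
    and "(INF i\<in>I. ereal (norm (f i))) > 0"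
    and "0 < \<epsilon>" and "\<epsilon> < 1" and "ereal \<epsilon> < (INF i\<in>I. ereal (norm (f i)))"
  shows "\<exists>P. finite P \<and> partition_on I P \<and> (\<forall>J\<in>P. riesz_sequence_eps \<epsilon> J f)"
proof -
  interpret G: group G
    unfolding G_def by (rule group_lattice_group)
  \<comment> \<open>Diagonal and off-diagonal deviations of \<open>\<delta>\<close> each add up to \<open>\<epsilon> * \<epsilon>\<^sup>2\<close>, which is at most
    \<open>\<epsilon> * A\<close> because every \<open>(norm (f i))\<^sup>2\<close>, and so \<open>A\<close>, is at least \<open>\<epsilon>\<^sup>2\<close>.\<close>
  define \<delta> where "\<delta> = \<epsilon> * \<epsilon>\<^sup>2 / 2"
  have \<delta>: "0 < \<delta>" using \<open>0 < \<epsilon>\<close> by (simp add: \<delta>_def)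
  have low: "\<epsilon>\<^sup>2 \<le> (norm (f i))\<^sup>2" if "i \<in> I" for i
  proof -
    have "ereal \<epsilon> < ereal (norm (f i))"
      using assms(13) INF_lower[OF that] by (rule less_le_trans)
    then show ?thesis
      using \<open>0 < \<epsilon>\<close> by (intro power_mono) auto
  qed
  have "lattice_abs d e \<one>\<^bsub>G\<^esub> \<le> 0"
    using lattice_abs_one[OF \<open>d \<ge> 1\<close>] unfolding G_def by simp
  then obtain K where "\<And>g. g \<in> carrier G \<Longrightarrow> finite {i\<in>I. a i = g}"
    and "\<And>g. g \<in> carrier G \<Longrightarrow> card {i\<in>I. a i = g} \<le> K"
    using G.bounded_fibres_of_finite_density assms(9) by blast
  then obtain col :: "'i \<Rightarrow> nat" where fin_col: "finite (col ` I)"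
    and small: "\<And>i X. \<lbrakk>i \<in> I; finite X; X \<subseteq> I; i \<notin> X; \<And>j. j \<in> X \<Longrightarrow> col j = col i\<rbrakk>
           \<Longrightarrow> (\<Sum>j\<in>X. cmod (cinner (f i) (f j))) \<le> \<delta>"
    using G.colouring_with_small_correlations[OF assms(3,7,8) _ _ \<delta>] by blast
  define bin where "bin = (\<lambda>i. \<lfloor>(norm (f i))\<^sup>2 / \<delta>\<rfloor>)"
  have fin_bin: "finite (bin ` I)"
  proof -
    obtain r where r: "\<And>i. i \<in> I \<Longrightarrow> cmod (cinner (f i) (f i)) \<le> r (a i \<otimes>\<^bsub>G\<^esub> inv\<^bsub>G\<^esub> a i)"
      using assms(8) unfolding l1_self_localized_def by blast
    have "(norm (f i))\<^sup>2 \<le> r \<one>\<^bsub>G\<^esub>" if "i \<in> I" for i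
      using r[OF that] assms(7) that by (auto simp: cinner_self Pi_iff norm_power)
    then have "bin ` I \<subseteq> {0..\<lfloor>r \<one>\<^bsub>G\<^esub> / \<delta>\<rfloor>}"
      using \<delta> by (auto simp: bin_def intro!: floor_mono divide_right_mono)
    then show ?thesis
      using finite_subset by blast
  qed
  have bin_dist: "\<bar>(norm (f i))\<^sup>2 - (norm (f k))\<^sup>2\<bar> \<le> \<delta>" if "bin i = bin k" for i k
  proof -
    have "\<bar>(norm (f i))\<^sup>2 / \<delta> - (norm (f k))\<^sup>2 / \<delta>\<bar> \<le> 1"
      using that unfolding bin_def by linarith
    then show ?thesis
      using \<delta> by (simp add: field_simps flip: diff_divide_distrib)
  qed
  define h where "h = (\<lambda>i. (col i, bin i))"
  define P where "P = (\<lambda>v. {i\<in>I. h i = v}) ` h ` I"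
  have "h ` I \<subseteq> col ` I \<times> bin ` I"
    by (auto simp: h_def)
  then have "finite P"
    unfolding P_def using fin_col fin_bin by (meson finite_SigmaI finite_imageI finite_subset)
  moreover have "partition_on I P"
    unfolding P_def by (rule partition_on_fibres)
  moreover have "riesz_sequence_eps \<epsilon> J f" if JP: "J \<in> P" for J
  proof -
    obtain k where k: "k \<in> I" and J: "J = {i\<in>I. h i = h k}"
      using JP by (auto simp: P_def)
    define A where "A = (norm (f k))\<^sup>2"
    have A: "\<epsilon>\<^sup>2 \<le> A" unfolding A_def by (rule low[OF k])
    then have "0 < A" using \<open>0 < \<epsilon>\<close> by (meson less_le_trans zero_less_power)
    then show ?thesis
    proof (rule riesz_sequence_eps_of_finite_bounds)
      fix X and c :: "'i \<Rightarrow> complex" assume X: "finite X" "X \<subseteq> J"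
      have "\<bar>(norm (\<Sum>i\<in>X. c i *\<^sub>C f i))\<^sup>2 - A * (\<Sum>i\<in>X. (cmod (c i))\<^sup>2)\<bar>
          \<le> (\<delta> + \<delta>) * (\<Sum>i\<in>X. (cmod (c i))\<^sup>2)"
      proof (rule finite_sum_norm_bounds[OF X(1)])
        fix i assume i: "i \<in> X"
        then show "\<bar>(norm (f i))\<^sup>2 - A\<bar> \<le> \<delta>"
          unfolding A_def using X J by (intro bin_dist) (auto simp: h_def)
        show "(\<Sum>j\<in>X - {i}. cmod (cinner (f i) (f j))) \<le> \<delta>"
        proof (rule small)
          fix j assume "j \<in> X - {i}"
          then have "j \<in> J" "i \<in> J"
            using i X(2) by blast+
          then show "col j = col i"
            by (simp add: J h_def)
        qed (use X J i in auto)
      qed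
      also have "\<dots> \<le> \<epsilon> * A * (\<Sum>i\<in>X. (cmod (c i))\<^sup>2)"
        using A \<open>0 < \<epsilon>\<close> by (intro mult_right_mono sum_nonneg) (auto simp: \<delta>_def)
      finally show "\<bar>(norm (\<Sum>i\<in>X. c i *\<^sub>C f i))\<^sup>2 - A * (\<Sum>i\<in>X. (cmod (c i))\<^sup>2)\<bar>
        \<le> \<epsilon> * A * (\<Sum>i\<in>X. (cmod (c i))\<^sup>2)" .
    qed
  qed
  ultimately show ?thesis by blast
qed

end
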